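(* Let $G_1$ and $G_2$ be looped simple graphs and $v\in V(G_1)$. The following are equivalent: (1) $G_2$ is isomorphic to the non-simple local complement $(G_1)^v_{ns}$; (2) there is a compatible isomorphism $\beta:M(IAS(G_1))\to M(IAS(G_2))$ with $f_\beta(w)=1$ for all $w\neq v$, and $f_\beta(v)=(\phi\chi)$ if $v$ is looped in $G_1$, $f_\beta(v)=(\phi\psi)$ if $v$ is not looped in $G_1$.
   Context: A looped simple graph is a finite graph in which each vertex may carry at most one loop and distinct non-loop edges join distinct pairs of vertices; $N(v)$ is the set of neighbors of $v$ other than $v$. The simple local complement $G^v_s$ complements all adjacencies between distinct elements of $N(v)$; the non-simple local complement $G^v_{ns}$ is obtained from $G^v_s$ by reversing the loop status of every element of $N(v)$. $A(G)$ is the adjacency matrix over $GF(2)$ (diagonal entry $1$ iff looped). $M(IAS(G))$ is the binary matroid represented by the columns of $(I\mid A(G)\mid I+A(G))$; its ground set consists of columns $v_\phi,v_\chi,v_\psi$, the columns of $v$ in $I$, $A(G)$, $I+A(G)$. $S_3$ is the permutation group of $\{\phi,\chi,\psi\}$. A compatible isomorphism $\beta$ is a matroid isomorphism mapping each cell $\{v_\phi,v_\chi,v_\psi\}$ onto some cell $\{w_\phi,w_\chi,w_\psi\}$; it induces a bijection $\beta:V(G_1)\to V(G_2)$ and $f_\beta:V(G_1)\to S_3$ with $\beta(v_\iota)=\beta(v)_{f_\beta(v)(\iota)}$. *)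

theory Defs
  imports "HOL-Library.Z2" "HOL-Combinatorics.Transposition"
begin

section \<open>Looped simple graphs and local complements\<close>

text \<open>A non-loop edge joining \<open>x\<close> and \<open>y\<close> is the doubleton \<open>{x, y}\<close>, and a loop at \<open>x\<close> is the
  singleton \<open>{x} = {x, x}\<close>; so \<open>{x, y} \<in> edges G\<close> covers both kinds of adjacency.\<close>

record 'a lgraph =
  verts :: "'a set"
  edges :: "'a set set"

definition looped_simple_graph :: "'a lgraph \<Rightarrow> bool" where
  "looped_simple_graph G \<longleftrightarrow>
     finite (verts G) \<and> (\<forall>e\<in>edges G. e \<subseteq> verts G \<and> (card e = 1 \<or> card e = 2))"

definition looped :: "'a lgraph \<Rightarrow> 'a \<Rightarrow> bool" where
  "looped G v \<longleftrightarrow> {v} \<in> edges G"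

definition nbrs :: "'a lgraph \<Rightarrow> 'a \<Rightarrow> 'a set" where
  "nbrs G v = {w \<in> verts G. w \<noteq> v \<and> {v, w} \<in> edges G}"

definition toggle_edges :: "'a set set \<Rightarrow> 'a lgraph \<Rightarrow> 'a lgraph" where
  "toggle_edges D G = G\<lparr>edges := (edges G - D) \<union> (D - edges G)\<rparr>"

definition simple_local_complement :: "'a lgraph \<Rightarrow> 'a \<Rightarrow> 'a lgraph" where
  "simple_local_complement G v =
     toggle_edges {{x, y} | x y. x \<in> nbrs G v \<and> y \<in> nbrs G v \<and> x \<noteq> y} G"

definition nonsimple_local_complement :: "'a lgraph \<Rightarrow> 'a \<Rightarrow> 'a lgraph" where
  "nonsimple_local_complement G v =
     toggle_edges {{x} | x. x \<in> nbrs G v} (simple_local_complement G v)"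

definition graph_isomorphic :: "'a lgraph \<Rightarrow> 'b lgraph \<Rightarrow> bool" where
  "graph_isomorphic G H \<longleftrightarrow>
     (\<exists>h. bij_betw h (verts G) (verts H) \<and>
          (\<forall>x\<in>verts G. \<forall>y\<in>verts G. {x, y} \<in> edges G \<longleftrightarrow> {h x, h y} \<in> edges H))"

lemma looped_simple_graph_nonsimple_local_complement:
  assumes "looped_simple_graph G"
  shows "looped_simple_graph (nonsimple_local_complement G v)"
  using assms
  by (auto simp: looped_simple_graph_def nonsimple_local_complement_def
      simple_local_complement_def toggle_edges_def nbrs_def card_insert_if)


section \<open>Binary matroids\<close>

record 'e matroid =
  ground :: "'e set"
  indep :: "'e set \<Rightarrow> bool"

text \<open>The matroid represented by a matrix \<open>M\<close> over \<open>GF(2)\<close> with row index set \<open>R\<close> and column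
  index set \<open>C\<close>. Its elements are the column indices rather than the columns themselves, so that
  equal columns give distinct (parallel) elements.\<close>

definition binary_matroid :: "'r set \<Rightarrow> 'e set \<Rightarrow> ('r \<Rightarrow> 'e \<Rightarrow> bit) \<Rightarrow> 'e matroid" where
  "binary_matroid R C M =
     \<lparr>ground = C,
      indep = (\<lambda>S. S \<subseteq> C \<and> finite S \<and>
        (\<forall>c. (\<forall>r\<in>R. (\<Sum>e\<in>S. c e * M r e) = 0) \<longrightarrow> (\<forall>e\<in>S. c e = 0)))\<rparr>"

definition matroid_iso :: "'e matroid \<Rightarrow> 'f matroid \<Rightarrow> ('e \<Rightarrow> 'f) \<Rightarrow> bool" where
  "matroid_iso M N \<beta> \<longleftrightarrow>
     bij_betw \<beta> (ground M) (ground N) \<and>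
     (\<forall>S\<subseteq>ground M. indep M S \<longleftrightarrow> indep N (\<beta> ` S))"


section \<open>The isotropic matroid of a graph\<close>

datatype label = Phi | Chi | Psi

text \<open>The pair \<open>(v, \<iota>)\<close> stands for the column \<open>v\<^sub>\<iota>\<close>.\<close>

definition identity_matrix :: "'a \<Rightarrow> 'a \<Rightarrow> bit" where
  "identity_matrix u w = of_bool (u = w)"

definition adjacency_matrix :: "'a lgraph \<Rightarrow> 'a \<Rightarrow> 'a \<Rightarrow> bit" where
  "adjacency_matrix G u w = of_bool ({u, w} \<in> edges G)"

fun IAS :: "'a lgraph \<Rightarrow> 'a \<Rightarrow> 'a \<times> label \<Rightarrow> bit" where
  "IAS G u (w, Phi) = identity_matrix u w"
| "IAS G u (w, Chi) = adjacency_matrix G u w"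
| "IAS G u (w, Psi) = identity_matrix u w + adjacency_matrix G u w"

definition M_IAS :: "'a lgraph \<Rightarrow> ('a \<times> label) matroid" where
  "M_IAS G = binary_matroid (verts G) (verts G \<times> UNIV) (IAS G)"

definition cell :: "'a \<Rightarrow> ('a \<times> label) set" where
  "cell v = {(v, Phi), (v, Chi), (v, Psi)}"

definition compatible_iso ::
  "'a lgraph \<Rightarrow> 'b lgraph \<Rightarrow> ('a \<times> label \<Rightarrow> 'b \<times> label) \<Rightarrow> bool" where
  "compatible_iso G H \<beta> \<longleftrightarrow>
     matroid_iso (M_IAS G) (M_IAS H) \<beta> \<and>
     (\<forall>v\<in>verts G. \<exists>w\<in>verts H. \<beta> ` cell v = cell w)"

definition induced_vertex_map :: "('a \<times> label \<Rightarrow> 'b \<times> label) \<Rightarrow> 'a \<Rightarrow> 'b" where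
  "induced_vertex_map \<beta> v = (THE w. \<beta> ` cell v = cell w)"

definition induced_perm :: "('a \<times> label \<Rightarrow> 'b \<times> label) \<Rightarrow> 'a \<Rightarrow> label \<Rightarrow> label" where
  "induced_perm \<beta> v \<iota> = snd (\<beta> (v, \<iota>))"

lemma cell_eq: "cell v = {v} \<times> UNIV"
  by (auto simp: cell_def intro: label.exhaust)

text \<open>The two maps induced by a compatible isomorphism have the intended properties.\<close>

lemma compatible_iso_induced:
  assumes \<beta>: "compatible_iso G H \<beta>" and v: "v \<in> verts G"
  shows "induced_vertex_map \<beta> v \<in> verts H"
    and "\<beta> (v, \<iota>) = (induced_vertex_map \<beta> v, induced_perm \<beta> v \<iota>)"
    and "bij (induced_perm \<beta> v)"
proof -
  obtain w where w: "w \<in> verts H" "\<beta> ` cell v = cell w"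
    using assms by (auto simp: compatible_iso_def)
  have w_eq: "induced_vertex_map \<beta> v = w"
    unfolding induced_vertex_map_def
    by (rule the_equality) (use w in \<open>auto simp: cell_eq\<close>)
  then show "induced_vertex_map \<beta> v \<in> verts H" using w by simp
  have *: "\<beta> (v, \<kappa>) = (w, induced_perm \<beta> v \<kappa>)" for \<kappa>
  proof -
    have "\<beta> (v, \<kappa>) \<in> cell w" using w(2) by (auto simp: cell_eq)
    then show ?thesis by (auto simp: cell_eq induced_perm_def)
  qed
  then show "\<beta> (v, \<iota>) = (induced_vertex_map \<beta> v, induced_perm \<beta> v \<iota>)"
    using w_eq by simp
  have "surj (induced_perm \<beta> v)"
    unfolding surj_def
  proof
    fix \<kappa>
    have "(w, \<kappa>) \<in> \<beta> ` cell v" using w(2) by (simp add: cell_eq)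
    then show "\<exists>\<mu>. \<kappa> = induced_perm \<beta> v \<mu>" using * by (auto simp: cell_eq)
  qed
  moreover have "finite (UNIV :: label set)"
    by (rule finite_subset[of _ "{Phi, Chi, Psi}"]) (auto intro: label.exhaust)
  ultimately show "bij (induced_perm \<beta> v)"
    by (simp add: bij_def finite_UNIV_surj_inj)
qed

lemma compatible_iso_bij_betw_verts:
  assumes \<beta>: "compatible_iso G H \<beta>"
  shows "bij_betw (induced_vertex_map \<beta>) (verts G) (verts H)"
proof -
  note ind = compatible_iso_induced[OF \<beta>]
  have bij: "bij_betw \<beta> (verts G \<times> UNIV) (verts H \<times> UNIV)"
    using \<beta> by (simp add: compatible_iso_def matroid_iso_def M_IAS_def binary_matroid_def)
  show ?thesis
  proof (rule bij_betw_imageI)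
    show "inj_on (induced_vertex_map \<beta>) (verts G)"
    proof (rule inj_onI)
      fix x y assume x: "x \<in> verts G" and y: "y \<in> verts G"
        and eq: "induced_vertex_map \<beta> x = induced_vertex_map \<beta> y"
      obtain \<mu> where "induced_perm \<beta> y \<mu> = induced_perm \<beta> x Phi"
        using ind(3)[OF y] by (metis bij_pointE)
      then have "\<beta> (x, Phi) = \<beta> (y, \<mu>)" using ind(2) x y eq by simp
      then show "x = y" using bij x y by (auto simp: bij_betw_def inj_on_def)
    qed
    show "induced_vertex_map \<beta> ` verts G = verts H"
    proof
      show "induced_vertex_map \<beta> ` verts G \<subseteq> verts H" using ind(1) by blast
      show "verts H \<subseteq> induced_vertex_map \<beta> ` verts G"
      proof
        fix w assume "w \<in> verts H"
        then have "(w, Phi) \<in> \<beta> ` (verts G \<times> UNIV)" using bij by (auto simp: bij_betw_def)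
        then obtain x \<kappa> where "x \<in> verts G" "\<beta> (x, \<kappa>) = (w, Phi)" by force
        then show "w \<in> induced_vertex_map \<beta> ` verts G" using ind(2)[of x \<kappa>] by auto
      qed
    qed
  qed
qed

end

theory Submission
  imports Defs
begin

text \<open>Adding row \<open>v\<close> of \<open>(I | A | I + A)\<close> to the rows indexed by the neighbours of \<open>v\<close> does not
  change the matroid, and the resulting matrix is the one of the non-simple local complement, except
  that the column \<open>v\<^sub>\<phi>\<close> has traded places with \<open>v\<^sub>\<chi>\<close> (if \<open>v\<close> is looped) or \<open>v\<^sub>\<psi>\<close> (otherwise).
  Conversely, a compatible isomorphism with trivial permutations comes from a graph isomorphism,
  because the fundamental circuit of \<open>w\<^sub>\<chi>\<close> in the basis of all \<open>x\<^sub>\<phi>\<close> determines column \<open>w\<close> of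
  the adjacency matrix. Composing with the isomorphism of the first part reduces the general case to
  this one.\<close>

section \<open>Isomorphisms of binary matroids\<close>

lemma matroid_iso_indep_iff:
  assumes "matroid_iso M N \<beta>" and "S \<subseteq> ground M"
  shows "indep N (\<beta> ` S) \<longleftrightarrow> indep M S"
  using assms by (simp add: matroid_iso_def)

lemma matroid_iso_comp:
  assumes \<beta>: "matroid_iso M N \<beta>" and \<gamma>: "matroid_iso N L \<gamma>"
  shows "matroid_iso M L (\<gamma> \<circ> \<beta>)"
  unfolding matroid_iso_def
proof (intro conjI allI impI)
  show "bij_betw (\<gamma> \<circ> \<beta>) (ground M) (ground L)"
    using assms by (auto simp: matroid_iso_def intro: bij_betw_trans)
  fix S assume S: "S \<subseteq> ground M"
  then have "\<beta> ` S \<subseteq> ground N"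
    using \<beta> by (auto simp: matroid_iso_def bij_betw_def)
  then show "indep M S \<longleftrightarrow> indep L ((\<gamma> \<circ> \<beta>) ` S)"
    unfolding image_comp[symmetric]
    using matroid_iso_indep_iff[OF \<beta> S] matroid_iso_indep_iff[OF \<gamma>] by simp
qed

lemma indep_binary_matroid_iff:
  "indep (binary_matroid R C M) S \<longleftrightarrow> S \<subseteq> C \<and> finite S \<and>
     (\<forall>c. (\<forall>r\<in>R. (\<Sum>e\<in>S. c e * M r e) = 0) \<longrightarrow> (\<forall>e\<in>S. c e = 0))"
  by (simp only: binary_matroid_def matroid.select_convs)

text \<open>Up to the renamings \<open>g\<close> and \<beta>, \<open>M'\<close> arises from
  \<open>M\<close> by adding \<open>t r\<close> times row \<open>p\<close> to each row
  \<open>r\<close>. Since \<open>t p = 0\<close>, row \<open>p\<close> itself survives, so the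
  operation is invertible and preserves all linear dependences among columns.\<close>

lemma binary_matroid_iso_pivot:
  fixes M :: "'r \<Rightarrow> 'e \<Rightarrow> bit" and M' :: "'s \<Rightarrow> 'f \<Rightarrow> bit"
  assumes g: "bij_betw g R R'" and \<beta>: "bij_betw \<beta> C C'"
    and p: "p \<in> R" "t p = 0"
    and entry: "\<And>r e. r \<in> R \<Longrightarrow> e \<in> C \<Longrightarrow> M' (g r) (\<beta> e) = M r e + t r * M p e"
  shows "matroid_iso (binary_matroid R C M) (binary_matroid R' C' M') \<beta>"
proof -
  have "indep (binary_matroid R C M) S \<longleftrightarrow> indep (binary_matroid R' C' M') (\<beta> ` S)"
    if S: "S \<subseteq> C" for S
  proof -
    have inj: "inj_on \<beta> S"
      using \<beta> S by (auto simp: bij_betw_def inj_on_subset)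
    have image: "\<beta> ` S \<subseteq> C'"
      using \<beta> S by (auto simp: bij_betw_def)
    have row: "(\<Sum>e\<in>\<beta> ` S. d e * M' (g r) e)
        = (\<Sum>e\<in>S. d (\<beta> e) * M r e) + t r * (\<Sum>e\<in>S. d (\<beta> e) * M p e)" if "r \<in> R" for d r
    proof -
      have "(\<Sum>e\<in>\<beta> ` S. d e * M' (g r) e) = (\<Sum>e\<in>S. d (\<beta> e) * (M r e + t r * M p e))"
        using that S by (subst sum.reindex[OF inj]) (auto simp: entry intro!: sum.cong)
      then show ?thesis
        by (simp only: distrib_left sum.distrib sum_distrib_left mult.left_commute)
    qed
    have kernel: "(\<forall>r\<in>R'. (\<Sum>e\<in>\<beta> ` S. d e * M' r e) = 0) \<longleftrightarrow>
        (\<forall>r\<in>R. (\<Sum>e\<in>S. d (\<beta> e) * M r e) = 0)" for d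
    proof -
      have "(\<forall>r\<in>R'. (\<Sum>e\<in>\<beta> ` S. d e * M' r e) = 0) \<longleftrightarrow>
        (\<forall>r\<in>R. (\<Sum>e\<in>\<beta> ` S. d e * M' (g r) e) = 0)"
        using g by (auto simp: bij_betw_def)
      also have "\<dots> \<longleftrightarrow> (\<forall>r\<in>R. (\<Sum>e\<in>S. d (\<beta> e) * M r e) + t r * (\<Sum>e\<in>S. d (\<beta> e) * M p e) = 0)"
        by (simp only: row cong: ball_cong)
      also have "\<dots> \<longleftrightarrow> (\<forall>r\<in>R. (\<Sum>e\<in>S. d (\<beta> e) * M r e) = 0)"
      proof (intro iffI ballI)
        fix r
        assume all: "\<forall>r\<in>R. (\<Sum>e\<in>S. d (\<beta> e) * M r e) + t r * (\<Sum>e\<in>S. d (\<beta> e) * M p e) = 0"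
          and r: "r \<in> R"
        \<comment> \<open>In row \<open>p\<close> the correction term drops out because
          \<open>t p = 0\<close>; what remains kills the correction in every other row.\<close>
        have "(\<Sum>e\<in>S. d (\<beta> e) * M p e) = 0"
          using bspec[OF all p(1)] by (simp only: p(2) mult_zero_left add_0_right)
        then show "(\<Sum>e\<in>S. d (\<beta> e) * M r e) = 0"
          using bspec[OF all r] by (simp only: mult_zero_right add_0_right)
      next
        fix r
        assume "\<forall>r\<in>R. (\<Sum>e\<in>S. d (\<beta> e) * M r e) = 0" and "r \<in> R"
        then show "(\<Sum>e\<in>S. d (\<beta> e) * M r e) + t r * (\<Sum>e\<in>S. d (\<beta> e) * M p e) = 0"
          using p(1) by (simp only: mult_zero_right add_0_right)
      qed
      finally show ?thesis .
    qed
    have "(\<forall>c. (\<forall>r\<in>R. (\<Sum>e\<in>S. c e * M r e) = 0) \<longrightarrow> (\<forall>e\<in>S. c e = 0)) \<longleftrightarrow>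
        (\<forall>d. (\<forall>r\<in>R'. (\<Sum>e\<in>\<beta> ` S. d e * M' r e) = 0) \<longrightarrow> (\<forall>e\<in>\<beta> ` S. d e = 0))"
      (is "?lhs \<longleftrightarrow> ?rhs")
    proof
      assume ?lhs
      then show ?rhs
        unfolding kernel
      proof (intro allI impI)
        fix d
        assume "\<forall>r\<in>R. (\<Sum>e\<in>S. d (\<beta> e) * M r e) = 0"
        with \<open>?lhs\<close>[rule_format, of "\<lambda>e. d (\<beta> e)"] show "\<forall>e\<in>\<beta> ` S. d e = 0"
          by blast
      qed
    next
      assume rhs: ?rhs
      show ?lhs
      proof (intro allI impI)
        fix c :: "'e \<Rightarrow> bit"
        assume c: "\<forall>r\<in>R. (\<Sum>e\<in>S. c e * M r e) = 0"
        \<comment> \<open>The coefficients on \<open>S\<close> are moved to its image along the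
          inverse of \<beta>.\<close>
        define d where "d = c \<circ> inv_into S \<beta>"
        have d: "d (\<beta> e) = c e" if "e \<in> S" for e
          using that inj by (simp add: d_def)
        have "\<forall>r\<in>R'. (\<Sum>e\<in>\<beta> ` S. d e * M' r e) = 0"
          unfolding kernel using c by (simp add: d)
        then show "\<forall>e\<in>S. c e = 0"
          using rhs d by auto
      qed
    qed
    then show ?thesis
      using S image inj by (simp only: indep_binary_matroid_iff finite_image_iff)
  qed
  then show ?thesis
    using \<beta> by (simp add: matroid_iso_def binary_matroid_def)
qed

lemma ground_M_IAS [simp]: "ground (M_IAS G) = verts G \<times> UNIV"
  by (simp add: M_IAS_def binary_matroid_def)

section \<open>Graph isomorphisms and the isotropic matroid\<close>

text \<open>A graph isomorphism merely renames rows and columns: the degenerate pivot with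
  \<open>t\<close> zero and \<open>v\<close> as row \<open>p\<close>.\<close>

lemma M_IAS_iso_of_graph_iso:
  assumes g: "bij_betw g (verts G) (verts H)"
    and edges: "\<And>x y. x \<in> verts G \<Longrightarrow> y \<in> verts G \<Longrightarrow> {g x, g y} \<in> edges H \<longleftrightarrow> {x, y} \<in> edges G"
    and v: "v \<in> verts G"
  shows "matroid_iso (M_IAS G) (M_IAS H) (map_prod g id)"
  unfolding M_IAS_def
proof (rule binary_matroid_iso_pivot[OF g _ v, where t = "\<lambda>_. 0"])
  show "bij_betw (map_prod g id) (verts G \<times> UNIV) (verts H \<times> (UNIV :: label set))"
    using g by (simp add: bij_betw_def map_prod_inj_on map_prod_surj_on)
  fix r and e :: "'a \<times> label"
  assume r: "r \<in> verts G" and "e \<in> verts G \<times> UNIV"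
  then obtain w \<iota> where e: "e = (w, \<iota>)" "w \<in> verts G"
    by auto
  have "g r = g w \<longleftrightarrow> r = w"
    using g r e by (auto simp: bij_betw_def inj_on_def)
  then show "IAS H (g r) (map_prod g id e) = IAS G r e + 0 * IAS G v e"
    using r e edges by (cases \<iota>) (simp_all add: identity_matrix_def adjacency_matrix_def)
qed simp

text \<open>The set is the basis of all \<open>x\<^sub>\<phi>\<close> with
  \<open>u\<^sub>\<phi>\<close> exchanged for \<open>w\<^sub>\<chi>\<close>. The remaining unit
  columns vanish in row \<open>u\<close>, so independence depends only on entry
  \<open>(u, w)\<close> of the adjacency matrix. Hence the matroid recovers every edge and
  loop.\<close>

lemma indep_M_IAS_exchange_iff:
  assumes fin: "finite (verts G)" and u: "u \<in> verts G" and w: "w \<in> verts G"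
  shows "indep (M_IAS G) (insert (w, Chi) ((verts G - {u}) \<times> {Phi})) \<longleftrightarrow> {u, w} \<in> edges G"
    (is "indep _ ?S \<longleftrightarrow> _")
proof -
  \<comment> \<open>Among the unit columns, row \<open>r\<close> meets only that of
    \<open>r\<close>, which is missing when \<open>r = u\<close>.\<close>
  have row: "(\<Sum>e\<in>?S. c e * IAS G r e)
      = c (w, Chi) * adjacency_matrix G r w + (if r = u then 0 else c (r, Phi))"
    if "r \<in> verts G" for c r
  proof -
    have "(\<Sum>e\<in>(verts G - {u}) \<times> {Phi}. c e * IAS G r e)
        = (\<Sum>x\<in>verts G - {u}. c (x, Phi) * identity_matrix r x)"
      by (rule sum.reindex_bij_witness[of _ "\<lambda>x. (x, Phi)" fst]) auto
    also have "\<dots> = (\<Sum>x\<in>verts G - {u}. if r = x then c (x, Phi) else 0)"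
      by (rule sum.cong) (auto simp: identity_matrix_def)
    also have "\<dots> = (if r = u then 0 else c (r, Phi))"
      using fin that by simp
    finally show ?thesis
      using fin by (subst sum.insert) auto
  qed
  have "indep (M_IAS G) ?S \<longleftrightarrow>
    (\<forall>c. (\<forall>r\<in>verts G. c (w, Chi) * adjacency_matrix G r w + (if r = u then 0 else c (r, Phi)) = 0)
       \<longrightarrow> (\<forall>e\<in>?S. c e = 0))"
  proof -
    have "?S \<subseteq> verts G \<times> UNIV" "finite ?S"
      using fin w by auto
    then show ?thesis
      unfolding M_IAS_def indep_binary_matroid_iff by (simp only: row simp_thms cong: ball_cong)
  qed
  also have "\<dots> \<longleftrightarrow> adjacency_matrix G u w = 1" (is "?lhs \<longleftrightarrow> ?rhs")
  proof
    assume lhs: ?lhs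
    \<comment> \<open>Column \<open>w\<^sub>\<chi>\<close> is the sum of the unit columns of all
      \<open>x\<close> with \<open>{x, w}\<close> an edge. If entry \<open>u\<close> is 0, this sum
      avoids \<open>u\<close>, and \<open>c\<close> is the resulting nontrivial dependence.\<close>
    define c where "c = (\<lambda>(x, \<iota>). if \<iota> = Chi then 1 else adjacency_matrix G x w)"
    show ?rhs
    proof (rule ccontr)
      assume "\<not> ?rhs"
      then have "\<forall>r\<in>verts G. c (w, Chi) * adjacency_matrix G r w
          + (if r = u then 0 else c (r, Phi)) = 0"
        by (auto simp: c_def)
      with lhs have "c (w, Chi) = 0"
        by blast
      then show False
        by (simp add: c_def)
    qed
  next
    assume rhs: ?rhs
    show ?lhs
    proof (intro allI impI)
      fix c :: "'a \<times> label \<Rightarrow> bit"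
      assume c: "\<forall>r\<in>verts G. c (w, Chi) * adjacency_matrix G r w
          + (if r = u then 0 else c (r, Phi)) = 0"
      \<comment> \<open>Row \<open>u\<close> contains only the term of
        \<open>w\<^sub>\<chi>\<close>, with entry 1; each other row then isolates one remaining
        coefficient.\<close>
      have "c (w, Chi) = 0"
        using c[rule_format, OF u] rhs by simp
      moreover from this have "c (r, Phi) = 0" if "r \<in> verts G" "r \<noteq> u" for r
        using c[rule_format, OF that(1)] that(2) by simp
      ultimately show "\<forall>e\<in>?S. c e = 0"
        by auto
    qed
  qed
  also have "\<dots> \<longleftrightarrow> {u, w} \<in> edges G"
    by (simp add: adjacency_matrix_def)
  finally show ?thesis .
qed

text \<open>As \<beta> keeps labels, it carries the exchange set of \<open>x\<close>,
  \<open>y\<close> in \<open>G\<close> to that of \<open>g x\<close>, \<open>g y\<close> in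
  \<open>H\<close>, and independence of these sets encodes adjacency.\<close>

lemma graph_iso_of_M_IAS_iso:
  assumes fin: "finite (verts G)" "finite (verts H)"
    and \<beta>: "matroid_iso (M_IAS G) (M_IAS H) \<beta>"
    and g: "bij_betw g (verts G) (verts H)"
    and \<beta>_eq: "\<And>x \<iota>. x \<in> verts G \<Longrightarrow> \<beta> (x, \<iota>) = (g x, \<iota>)"
    and x: "x \<in> verts G" and y: "y \<in> verts G"
  shows "{g x, g y} \<in> edges H \<longleftrightarrow> {x, y} \<in> edges G"
proof -
  let ?S = "insert (y, Chi) ((verts G - {x}) \<times> {Phi})"
  have "g ` (verts G - {x}) = verts H - {g x}"
    using g x by (auto simp: bij_betw_def inj_on_def)
  moreover have "\<beta> ` ((verts G - {x}) \<times> {Phi}) = (g ` (verts G - {x})) \<times> {Phi}"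
    by (force simp: \<beta>_eq image_iff)
  ultimately have "\<beta> ` ?S = insert (g y, Chi) ((verts H - {g x}) \<times> {Phi})"
    by (simp add: \<beta>_eq y)
  moreover have "indep (M_IAS H) (\<beta> ` ?S) \<longleftrightarrow> indep (M_IAS G) ?S"
    by (rule matroid_iso_indep_iff[OF \<beta>]) (use y in auto)
  moreover have "g x \<in> verts H" "g y \<in> verts H"
    using g x y by (auto simp: bij_betw_def)
  ultimately show ?thesis
    using indep_M_IAS_exchange_iff fin x y by metis
qed

lemma graph_isomorphic_sym:
  assumes "graph_isomorphic G H"
  shows "graph_isomorphic H G"
proof -
  obtain h where h: "bij_betw h (verts G) (verts H)"
    and edges: "\<And>x y. x \<in> verts G \<Longrightarrow> y \<in> verts G \<Longrightarrow> {x, y} \<in> edges G \<longleftrightarrow> {h x, h y} \<in> edges H"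
    using assms by (auto simp: graph_isomorphic_def)
  let ?g = "inv_into (verts G) h"
  have "bij_betw ?g (verts H) (verts G)"
    using h by (rule bij_betw_inv_into)
  moreover have "?g x \<in> verts G" "h (?g x) = x" if "x \<in> verts H" for x
    using h that by (auto simp: bij_betw_def inv_into_into f_inv_into_f)
  ultimately show ?thesis
    using edges unfolding graph_isomorphic_def by (metis (no_types, lifting))
qed

section \<open>Local complementation and the isotropic matroid\<close>

lemma verts_nonsimple_local_complement [simp]:
  "verts (nonsimple_local_complement G v) = verts G"
  by (simp add: nonsimple_local_complement_def simple_local_complement_def toggle_edges_def)

lemma edges_nonsimple_local_complement:
  "{x, y} \<in> edges (nonsimple_local_complement G v) \<longleftrightarrow>
     ({x, y} \<in> edges G) \<noteq> (x \<in> nbrs G v \<and> y \<in> nbrs G v)"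
proof -
  have "{x, y} \<in> {{a, b} | a b. a \<in> nbrs G v \<and> b \<in> nbrs G v \<and> a \<noteq> b} \<longleftrightarrow>
      x \<noteq> y \<and> x \<in> nbrs G v \<and> y \<in> nbrs G v"
    by (auto simp: doubleton_eq_iff)
  moreover have "{x, y} \<in> {{a} | a. a \<in> nbrs G v} \<longleftrightarrow> x = y \<and> x \<in> nbrs G v"
    by auto
  ultimately show ?thesis
    unfolding nonsimple_local_complement_def simple_local_complement_def toggle_edges_def
    by auto
qed

text \<open>Over GF(2), toggling is adding 1. The outer product of the indicator of
  \<open>nbrs G v\<close> with itself is exactly what adding row \<open>v\<close> to its neighbours'
  rows contributes to the columns \<open>w\<^sub>\<chi>\<close> with \<open>w\<close> other than
  \<open>v\<close>.\<close>

lemma adjacency_matrix_nonsimple_local_complement: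
  "adjacency_matrix (nonsimple_local_complement G v) x y =
     adjacency_matrix G x y + of_bool (x \<in> nbrs G v) * of_bool (y \<in> nbrs G v)"
  by (auto simp: adjacency_matrix_def edges_nonsimple_local_complement)

text \<open>Exchanges \<open>v\<^sub>\<phi>\<close> with whichever of \<open>v\<^sub>\<chi>\<close>,
  \<open>v\<^sub>\<psi>\<close> has entry 1 in row \<open>v\<close>.\<close>

definition pivot_perm :: "'a lgraph \<Rightarrow> 'a \<Rightarrow> label \<Rightarrow> label" where
  "pivot_perm G v = (if looped G v then transpose Phi Chi else transpose Phi Psi)"

definition pivot_relabel :: "'a lgraph \<Rightarrow> 'a \<Rightarrow> 'a \<times> label \<Rightarrow> 'a \<times> label" where
  "pivot_relabel G v = (\<lambda>(x, \<iota>). (x, if x = v then pivot_perm G v \<iota> else \<iota>))"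

lemma pivot_perm_pivot_perm [simp]: "pivot_perm G v (pivot_perm G v \<iota>) = \<iota>"
  by (simp add: pivot_perm_def)

lemma pivot_relabel_pivot_relabel [simp]: "pivot_relabel G v (pivot_relabel G v e) = e"
  by (simp add: pivot_relabel_def split: prod.split)

lemma bij_betw_pivot_relabel: "bij_betw (pivot_relabel G v) (V \<times> UNIV) (V \<times> UNIV)"
  by (rule bij_betw_byWitness[where f' = "pivot_relabel G v"]) (auto simp: pivot_relabel_def)

text \<open>The two columns of \<open>v\<close> with entry 1 in row \<open>v\<close> are the unit
  vector and the unit vector plus the indicator of the neighbourhood. Adding row \<open>v\<close> to
  the neighbours' rows swaps them and fixes the third column. As \<open>v\<close> is not its own
  neighbour, its adjacency column is the same in both graphs.\<close>

lemma matroid_iso_pivot_relabel: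
  assumes v: "v \<in> verts G"
  shows "matroid_iso (M_IAS G) (M_IAS (nonsimple_local_complement G v)) (pivot_relabel G v)"
  unfolding M_IAS_def verts_nonsimple_local_complement
proof (rule binary_matroid_iso_pivot[OF bij_betw_id bij_betw_pivot_relabel v,
      where t = "\<lambda>r. of_bool (r \<in> nbrs G v)"])
  show "of_bool (v \<in> nbrs G v) = (0 :: bit)"
    by (simp add: nbrs_def)
  fix r and e :: "'a \<times> label"
  assume r: "r \<in> verts G" and "e \<in> verts G \<times> UNIV"
  then obtain w \<iota> where e: "e = (w, \<iota>)" and w: "w \<in> verts G"
    by auto
  have v_notin: "v \<notin> nbrs G v"
    by (simp add: nbrs_def)
  have adj: "adjacency_matrix G v x = of_bool (x \<in> nbrs G v)"
      "adjacency_matrix G x v = of_bool (x \<in> nbrs G v)" if "x \<in> verts G" "x \<noteq> v" for x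
    using that by (simp_all add: adjacency_matrix_def nbrs_def insert_commute)
  have loop: "adjacency_matrix G v v = of_bool (looped G v)"
    by (simp add: adjacency_matrix_def looped_def)
  show "IAS (nonsimple_local_complement G v) (id r) (pivot_relabel G v e)
      = IAS G r e + of_bool (r \<in> nbrs G v) * IAS G v e"
  proof (cases "w = v")
    \<comment> \<open>Here \<open>IAS G v e\<close> is 0 for \<open>Phi\<close>; for the other
      labels it is 1 exactly when \<open>w\<close> is a neighbour of \<open>v\<close>.\<close>
    case False
    then show ?thesis
      using w v_notin
      by (cases "r \<in> nbrs G v"; cases "w \<in> nbrs G v"; cases \<iota>)
        (simp_all add: e pivot_relabel_def identity_matrix_def adj
          adjacency_matrix_nonsimple_local_complement)
  next
    case True
    then show ?thesis
      using r v_notin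
      by (cases "r = v"; cases "looped G v"; cases \<iota>)
        (simp_all add: e pivot_relabel_def pivot_perm_def identity_matrix_def adj loop
          adjacency_matrix_nonsimple_local_complement)
  qed
qed

theorem theorem10:
  fixes G1 :: "'a lgraph" and G2 :: "'b lgraph" and v :: 'a
  assumes "looped_simple_graph G1" and "looped_simple_graph G2" and "v \<in> verts G1"
  shows "graph_isomorphic G2 (nonsimple_local_complement G1 v) \<longleftrightarrow>
    (\<exists>\<beta>. compatible_iso G1 G2 \<beta> \<and>
         (\<forall>w\<in>verts G1. w \<noteq> v \<longrightarrow> induced_perm \<beta> w = id) \<and>
         induced_perm \<beta> v =
           (if looped G1 v then transpose Phi Chi else transpose Phi Psi))"
  unfolding pivot_perm_def[symmetric]
proof
  let ?H = "nonsimple_local_complement G1 v" and ?\<tau> = "pivot_relabel G1 v"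
  note \<tau> = matroid_iso_pivot_relabel[OF assms(3)]
  {
    assume "graph_isomorphic G2 ?H"
    then obtain g where g: "bij_betw g (verts G1) (verts G2)"
      and edges: "\<forall>x\<in>verts G1. \<forall>y\<in>verts G1. {x, y} \<in> edges ?H \<longleftrightarrow> {g x, g y} \<in> edges G2"
      using graph_isomorphic_sym[of G2 ?H] by (auto simp: graph_isomorphic_def)
    \<comment> \<open>First the pivot onto the local complement, then the renaming of its vertices
      by \<open>g\<close>.\<close>
    define \<beta> where "\<beta> = map_prod g id \<circ> ?\<tau>"
    have "matroid_iso (M_IAS ?H) (M_IAS G2) (map_prod g id)"
      by (rule M_IAS_iso_of_graph_iso[where v = v]) (use g edges assms in auto)
    then have iso: "matroid_iso (M_IAS G1) (M_IAS G2) \<beta>"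
      unfolding \<beta>_def by (rule matroid_iso_comp[OF \<tau>])
    have \<beta>_eq: "\<beta> (x, \<iota>) = (g x, if x = v then pivot_perm G1 v \<iota> else \<iota>)" for x \<iota>
      by (simp add: \<beta>_def pivot_relabel_def)
    have "\<beta> ` cell x = cell (g x)" for x
      by (auto simp: cell_eq \<beta>_eq image_iff) (metis pivot_perm_pivot_perm)
    then have "compatible_iso G1 G2 \<beta>"
      using iso g by (auto simp: compatible_iso_def bij_betw_def)
    moreover have "induced_perm \<beta> w = (if w = v then pivot_perm G1 v else id)" for w
      by (auto simp: induced_perm_def \<beta>_eq)
    ultimately show "\<exists>\<beta>. compatible_iso G1 G2 \<beta> \<and>
        (\<forall>w\<in>verts G1. w \<noteq> v \<longrightarrow> induced_perm \<beta> w = id) \<and> induced_perm \<beta> v = pivot_perm G1 v"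
      by auto
  }
  {
    assume "\<exists>\<beta>. compatible_iso G1 G2 \<beta> \<and>
        (\<forall>w\<in>verts G1. w \<noteq> v \<longrightarrow> induced_perm \<beta> w = id) \<and> induced_perm \<beta> v = pivot_perm G1 v"
    then obtain \<beta> where \<beta>: "compatible_iso G1 G2 \<beta>"
      and perm: "\<And>w. w \<in> verts G1 \<Longrightarrow> w \<noteq> v \<Longrightarrow> induced_perm \<beta> w = id"
        "induced_perm \<beta> v = pivot_perm G1 v"
      by auto
    let ?g = "induced_vertex_map \<beta>"
    have g: "bij_betw ?g (verts ?H) (verts G2)"
      using compatible_iso_bij_betw_verts[OF \<beta>] by simp
    \<comment> \<open>The relabelling is an involution, so it is also an isomorphism in the reverse
      direction.\<close>
    have "matroid_iso (M_IAS ?H) (M_IAS G1) ?\<tau>"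
      unfolding matroid_iso_def
    proof (intro conjI allI impI)
      show "bij_betw ?\<tau> (ground (M_IAS ?H)) (ground (M_IAS G1))"
        by (simp add: bij_betw_pivot_relabel)
      fix S assume "S \<subseteq> ground (M_IAS ?H)"
      then have "?\<tau> ` S \<subseteq> ground (M_IAS G1)"
        by (auto simp: pivot_relabel_def)
      from matroid_iso_indep_iff[OF \<tau> this]
      show "indep (M_IAS ?H) S \<longleftrightarrow> indep (M_IAS G1) (?\<tau> ` S)"
        by (simp add: image_comp comp_def)
    qed
    then have "matroid_iso (M_IAS ?H) (M_IAS G2) (\<beta> \<circ> ?\<tau>)"
      using \<beta> by (auto simp: compatible_iso_def intro: matroid_iso_comp)
    \<comment> \<open>At \<open>v\<close> the permutation of \<beta> cancels that of the
      relabelling; elsewhere both are trivial. The composite keeps all labels, so its vertex map is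
      a graph isomorphism.\<close>
    moreover have "(\<beta> \<circ> ?\<tau>) (x, \<iota>) = (?g x, \<iota>)" if "x \<in> verts ?H" for x \<iota>
      using compatible_iso_induced(2)[OF \<beta>, of x] perm that by (simp add: pivot_relabel_def)
    ultimately have "{?g x, ?g y} \<in> edges G2 \<longleftrightarrow> {x, y} \<in> edges ?H"
      if "x \<in> verts ?H" "y \<in> verts ?H" for x y
      using graph_iso_of_M_IAS_iso[OF _ _ _ g] assms that
      by (simp add: looped_simple_graph_def)
    then have "graph_isomorphic ?H G2"
      unfolding graph_isomorphic_def using g by blast
    then show "graph_isomorphic G2 ?H"
      by (rule graph_isomorphic_sym)
  }
qed

end
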